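(* Let $\lambda>0$, let $n\ge2$ be an integer, and let $V^{(n)}$ be the multiple iterated Poisson process of order $n$ with intensity $\lambda$. Let $J_1^{(n)}$ be its first jump time. Then for each integer $k\ge1$, $$P\bigl(V^{(n)}_{J_1^{(n)}}=k\bigr)=\frac{P(V_1^{(n-1)}=k)}{P(V_1^{(n-1)}\ge1)}.$$
   Context: Let $N^1,N^2,\dots$ be independent Poisson processes, all with the same intensity $\lambda>0$. The multiple iterated Poisson process (MIPP) is defined by $V_t^{(1)}=N_t^1$ and $V_t^{(m)}=N^m_{V_t^{(m-1)}}$ for $m\ge2$ (the process $N^m$ evaluated at time $V_t^{(m-1)}$). The first jump time is $J_1^{(n)}=\inf\{t\ge0: V_t^{(n)}\ne 0\}$. *)

theory Defs
  imports "HOL-Probability.Probability"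
begin

text \<open>
  The time axis is the half-line \<open>{0..}\<close>; values of a process at negative times are irrelevant.
  As usual for a counting process, the path conditions hold for every outcome.  The truncated
  subtraction on \<^typ>\<open>nat\<close> is harmless because paths are nondecreasing.
\<close>

definition poisson_process ::
    "'a measure \<Rightarrow> real \<Rightarrow> (real \<Rightarrow> 'a \<Rightarrow> nat) \<Rightarrow> bool" where
  "poisson_process M l X \<longleftrightarrow>
     (\<forall>t\<ge>0. X t \<in> measurable M (count_space UNIV)) \<and>
     (\<forall>\<omega>\<in>space M. X 0 \<omega> = 0 \<and> mono_on {0..} (\<lambda>t. X t \<omega>) \<and>
        (\<forall>t\<ge>0. continuous (at_right t) (\<lambda>s. X s \<omega>))) \<and>
     (\<forall>(t :: nat \<Rightarrow> real) m. 0 \<le> t 0 \<and> (\<forall>i<m. t i < t (Suc i)) \<longrightarrow>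
        prob_space.indep_vars M (\<lambda>_. count_space UNIV)
          (\<lambda>i \<omega>. X (t (Suc i)) \<omega> - X (t i) \<omega>) {..<m}) \<and>
     (\<forall>s t. 0 \<le> s \<and> s < t \<longrightarrow>
        distr M (count_space UNIV) (\<lambda>\<omega>. X t \<omega> - X s \<omega>) =
        measure_pmf (poisson_pmf (l * (t - s))))"

text \<open>
  Independence of processes is independence of their paths as random elements of the product space
  over the time axis, i.e. independence of the sigma-algebras generated by the whole processes.
\<close>

definition indep_processes ::
    "'a measure \<Rightarrow> 'i set \<Rightarrow> ('i \<Rightarrow> real \<Rightarrow> 'a \<Rightarrow> nat) \<Rightarrow> bool" where
  "indep_processes M I N \<longleftrightarrow>
     prob_space.indep_vars M (\<lambda>_. PiM {0..} (\<lambda>_. count_space UNIV))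
       (\<lambda>i \<omega>. \<lambda>t\<in>{0..}. N i t \<omega>) I"

text \<open>Orders start at 1; the value at order 0 is a dummy.\<close>

fun mipp :: "(nat \<Rightarrow> real \<Rightarrow> 'a \<Rightarrow> nat) \<Rightarrow> nat \<Rightarrow> real \<Rightarrow> 'a \<Rightarrow> nat" where
  "mipp N 0 t \<omega> = 0"
| "mipp N (Suc 0) t \<omega> = N 1 t \<omega>"
| "mipp N (Suc (Suc m)) t \<omega> = N (Suc (Suc m)) (real (mipp N (Suc m) t \<omega>)) \<omega>"

text \<open>Extended-real valued, so that a path that never leaves 0 has first jump time \<open>\<infinity>\<close>.\<close>

definition first_jump_time :: "(real \<Rightarrow> 'a \<Rightarrow> nat) \<Rightarrow> 'a \<Rightarrow> ereal" where
  "first_jump_time X \<omega> = Inf {ereal t | t. 0 \<le> t \<and> X t \<omega> \<noteq> 0}"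

end

theory Submission
  imports Defs "HOL-Real_Asymp.Real_Asymp"
begin

text \<open>
  By right continuity the first value of \<open>V = mipp N n\<close> is, for every outcome, the first nonzero value seen
  on a grid of sufficiently small mesh \<open>h\<close>.  On a grid, stationarity and independence of the
  increments of \<open>V\<close> give a geometric series, so that the first nonzero value is \<open>k\<close> with
  probability \<open>P(V\<^sub>h = k) / P(V\<^sub>h \<ge> 1)\<close>.  As \<open>h\<close> tends to 0, conditioning on \<open>N 1 h\<close> shows
  that \<open>P(V\<^sub>h \<in> A) / h\<close> tends to \<open>l\<close> times the probability that the iterate of order \<open>n - 1\<close>
  at time 1 lies in \<open>A\<close>, for every \<open>A\<close> not containing 0.
\<close>

section \<open>Laws of the iterates and their behaviour at small times\<close>

text \<open>The library's \<^const>\<open>poisson_pmf\<close> is only meaningful for positive rates; time 0 needs rate 0.\<close>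

definition poisson_pmf0 :: "real \<Rightarrow> nat pmf" where
  "poisson_pmf0 r = (if r = 0 then return_pmf 0 else poisson_pmf r)"

lemma pmf_poisson_pmf0:
  assumes "0 \<le> r"
  shows "pmf (poisson_pmf0 r) k = r ^ k / fact k * exp (- r)"
  using assms by (cases k) (auto simp: poisson_pmf0_def)

text \<open>The index \<open>m\<close> corresponds to the order \<open>Suc m\<close> of \<^const>\<open>mipp\<close>.\<close>

primrec iterated_poisson_pmf :: "real \<Rightarrow> nat \<Rightarrow> real \<Rightarrow> nat pmf" where
  "iterated_poisson_pmf l 0 t = poisson_pmf0 (l * t)"
| "iterated_poisson_pmf l (Suc m) t =
     bind_pmf (iterated_poisson_pmf l m t) (\<lambda>j. poisson_pmf0 (l * real j))"

text \<open>Composition can also be peeled off at the clock \<open>N 1\<close>, which is the one run in real time.\<close>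

lemma iterated_poisson_pmf_Suc_left:
  "iterated_poisson_pmf l (Suc m) t =
     bind_pmf (poisson_pmf0 (l * t)) (\<lambda>j. iterated_poisson_pmf l m (real j))"
proof (induction m)
  case (Suc m)
  have "iterated_poisson_pmf l (Suc (Suc m)) t =
      bind_pmf (iterated_poisson_pmf l (Suc m) t) (\<lambda>j. poisson_pmf0 (l * real j))"
    by (rule iterated_poisson_pmf.simps)
  then show ?case
    unfolding Suc.IH by (simp add: bind_assoc_pmf)
qed simp

lemma iterated_poisson_pmf_0 [simp]: "iterated_poisson_pmf l m 0 = return_pmf 0"
  by (induction m) (simp_all add: poisson_pmf0_def bind_return_pmf)

text \<open>When one level takes the value 1, the next runs for time 1 at a positive rate and can be
  1 again. This keeps the denominators of the later quotients positive.\<close>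

lemma one_in_set_iterated_poisson_pmf:
  assumes "0 < l" "0 < t"
  shows "1 \<in> set_pmf (iterated_poisson_pmf l m t)"
proof (induction m)
  case (Suc m)
  moreover have "1 \<in> set_pmf (poisson_pmf0 (l * real 1))"
    using assms by (simp add: poisson_pmf0_def)
  ultimately show ?case by (auto simp del: of_nat_1 intro!: bexI[of _ "Suc 0"])
qed (use assms in \<open>simp add: poisson_pmf0_def\<close>)

lemma measure_iterated_poisson_pmf_pos:
  assumes "0 < l" "0 < t" "1 \<in> A"
  shows "0 < measure (iterated_poisson_pmf l m t) A"
  using one_in_set_iterated_poisson_pmf[OF assms(1,2), of m] assms(3)
  by (auto simp: measure_pmf_posI)

lemma measure_bind_pmf_expectation:
  "measure (measure_pmf (bind_pmf p q)) A = measure_pmf.expectation p (\<lambda>x. measure (q x) A)"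
proof -
  have int: "integrable (measure_pmf p) (\<lambda>x. measure (q x) A)"
    by (rule measure_pmf.integrable_const_bound[where B = 1]) auto
  have "ennreal (measure (bind_pmf p q) A) = (\<integral>\<^sup>+x. ennreal (measure (q x) A) \<partial>p)"
    by (simp flip: measure_pmf.emeasure_eq_measure)
  also have "\<dots> = ennreal (measure_pmf.expectation p (\<lambda>x. measure (q x) A))"
    by (rule nn_integral_eq_integral[OF int]) auto
  finally show ?thesis
    by (simp add: integral_nonneg_AE)
qed

text \<open>In a short time \<open>h\<close> the clock \<open>N 1\<close> ticks once with probability \<open>l h + o(h)\<close>, and
  more than once with probability \<open>o(h)\<close>.\<close>

lemma iterated_poisson_pmf_small_time:
  assumes l: "0 < l" and A: "0 \<notin> A"
  shows "((\<lambda>h. measure (iterated_poisson_pmf l (Suc m) h) A / h) \<longlongrightarrow>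
           l * measure (iterated_poisson_pmf l m 1) A) (at_right 0)"
proof -
  \<comment> \<open>\<open>f j\<close> is the chance that the remaining levels end in
    \<open>A\<close> when the clock reads \<open>j\<close>. Since 0 is not in \<open>A\<close> and
    time 0 leads to 0, \<open>f 0\<close> vanishes.\<close>
  define f where "f j = measure (iterated_poisson_pmf l m (real j)) A" for j :: nat
  define P where "P h = measure (iterated_poisson_pmf l (Suc m) h) A" for h
  have f: "f 0 = 0" "0 \<le> f j" "f j \<le> 1" for j
    using A by (auto simp: f_def measure_return)
  have f_bound: "\<bar>f j\<bar> \<le> 2" for j
    using f(2,3)[of j] by simp
  \<comment> \<open>The lower bound keeps only the event of exactly one tick; the upper bound
    estimates \<open>f\<close> by 1 on the event of two or more ticks.\<close>
  have bounds: "l * h * exp (- (l * h)) * f 1 \<le> P h \<and>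
      P h \<le> l * h * exp (- (l * h)) * f 1 + (1 - exp (- (l * h)) - l * h * exp (- (l * h)))"
    if h: "0 < h" for h
  proof -
    define p where "p = poisson_pmf0 (l * h)"
    have p: "pmf p 0 = exp (- (l * h))" "pmf p 1 = l * h * exp (- (l * h))"
      using l h by (simp_all add: p_def pmf_poisson_pmf0)
    have P: "P h = measure_pmf.expectation p f"
      unfolding P_def iterated_poisson_pmf_Suc_left measure_bind_pmf_expectation p_def f_def ..
    have int: "integrable (measure_pmf p) g" if "\<And>x. \<bar>g x\<bar> \<le> 2" for g :: "nat \<Rightarrow> real"
      by (rule measure_pmf.integrable_const_bound[where B = 2]) (use that in auto)
    have e1: "measure p {1} = pmf p 1"
      by (simp add: pmf.rep_eq)
    have e2: "measure p (- {0, 1}) = 1 - pmf p 0 - pmf p 1"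
      using prob_space.prob_compl[OF prob_space_measure_pmf[of p], of "{0, 1}"]
      by (simp add: Compl_eq_Diff_UNIV measure_measure_pmf_finite)
    have "measure_pmf.expectation p (\<lambda>j. f 1 * indicator {1} j) \<le> measure_pmf.expectation p f"
    proof (rule integral_mono)
      show "integrable (measure_pmf p) (\<lambda>j. f 1 * indicator {1} j)"
        by (rule int) (use f(2,3)[of 1] in \<open>auto simp: indicator_def\<close>)
      show "integrable (measure_pmf p) f"
        by (rule int) (rule f_bound)
    qed (use f in \<open>auto simp: indicator_def\<close>)
    moreover have "measure_pmf.expectation p f \<le>
        measure_pmf.expectation p (\<lambda>j. f 1 * indicator {1} j + indicator (- {0, 1}) j)"
    proof (rule integral_mono)
      show "integrable (measure_pmf p) (\<lambda>j. f 1 * indicator {1} j + indicator (- {0, 1}) j)"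
        by (rule int) (use f(2,3)[of 1] in \<open>auto simp: indicator_def\<close>)
      show "integrable (measure_pmf p) f"
        by (rule int) (rule f_bound)
    qed (use f in \<open>auto simp: indicator_def\<close>)
    moreover have "measure_pmf.expectation p (\<lambda>j. f 1 * indicator {1} j + indicator (- {0, 1}) j) =
        f 1 * pmf p 1 + (1 - pmf p 0 - pmf p 1)"
      by (subst Bochner_Integration.integral_add)
        (simp_all add: measure_pmf.emeasure_eq_measure e1[simplified] e2[simplified])
    ultimately show ?thesis
      by (simp add: P p[simplified] e1[simplified] mult.commute)
  qed
  have "((\<lambda>h. P h / h) \<longlongrightarrow> l * f 1) (at_right 0)"
  proof (rule tendsto_sandwich)
    show "\<forall>\<^sub>F h in at_right 0. l * exp (- (l * h)) * f 1 \<le> P h / h"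
      using bounds by (auto simp: eventually_at_right_field field_simps intro!: exI[of _ 1])
    show "\<forall>\<^sub>F h in at_right 0. P h / h \<le>
        l * exp (- (l * h)) * f 1 + (1 - exp (- (l * h)) - l * h * exp (- (l * h))) / h"
      using bounds by (auto simp: eventually_at_right_field field_simps intro!: exI[of _ 1])
    show "((\<lambda>h. l * exp (- (l * h)) * f 1) \<longlongrightarrow> l * f 1) (at_right 0)"
      by (auto intro!: tendsto_eq_intros)
    \<comment> \<open>The chance of two or more ticks is of order \<open>h^2\<close>, hence still
      negligible after division by \<open>h\<close>.\<close>
    have "((\<lambda>h. (1 - exp (- (l * h)) - l * h * exp (- (l * h))) / h) \<longlongrightarrow> 0) (at_right 0)"
      by real_asymp
    moreover have "((\<lambda>h. l * exp (- (l * h)) * f 1) \<longlongrightarrow> l * f 1) (at_right 0)"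
      by (auto intro!: tendsto_eq_intros)
    ultimately show "((\<lambda>h. l * exp (- (l * h)) * f 1 +
        (1 - exp (- (l * h)) - l * h * exp (- (l * h))) / h) \<longlongrightarrow> l * f 1) (at_right 0)"
      using tendsto_add by fastforce
  qed
  then show ?thesis
    by (simp add: P_def f_def)
qed

section \<open>Joint laws of discrete random variables\<close>

lemma measurable_Pair_count_space:
  fixes X :: "'a \<Rightarrow> 'b::countable" and Y :: "'a \<Rightarrow> 'c::countable"
  assumes "X \<in> measurable M (count_space UNIV)" "Y \<in> measurable M (count_space UNIV)"
  shows "(\<lambda>\<omega>. (X \<omega>, Y \<omega>)) \<in> measurable M (count_space UNIV)"
  using measurable_Pair[OF assms] by (simp add: pair_measure_countable)

lemma measurable_Pair_increment:
  fixes X Y :: "'a \<Rightarrow> nat"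
  assumes "X \<in> measurable M (count_space UNIV)" "Y \<in> measurable M (count_space UNIV)"
  shows "(\<lambda>\<omega>. (X \<omega>, Y \<omega> - X \<omega>)) \<in> measurable M (count_space UNIV)"
  using measurable_compose[OF measurable_Pair_count_space[OF assms],
      of "\<lambda>(x, y). (x, y - x)" "count_space UNIV"] by simp

lemma distr_comp_count_space:
  assumes "X \<in> measurable M (count_space UNIV)"
    and "distr M (count_space UNIV) X = measure_pmf p"
  shows "distr M (count_space UNIV) (\<lambda>\<omega>. g (X \<omega>)) = measure_pmf (map_pmf g p)"
  using distr_distr[of g "count_space UNIV" "count_space UNIV" X M] assms
  by (simp add: map_pmf_rep_eq comp_def)

context prob_space
begin

lemma emeasure_indep_var_eq:
  assumes X: "distr M (count_space UNIV) X = measure_pmf p"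
    and Y: "distr M (count_space UNIV) Y = measure_pmf q"
    and indep: "indep_var (count_space UNIV) X (count_space UNIV) Y"
  shows "emeasure M {\<omega> \<in> space M. X \<omega> = x \<and> Y \<omega> = y} = ennreal (pmf p x) * ennreal (pmf q y)"
proof -
  have [measurable]: "X \<in> measurable M (count_space UNIV)" "Y \<in> measurable M (count_space UNIV)"
    using indep_var_rv1[OF indep] indep_var_rv2[OF indep] by auto
  have "prob {\<omega> \<in> space M. X \<omega> = x \<and> Y \<omega> = y} =
      prob (X -` {x} \<inter> space M) * prob (Y -` {y} \<inter> space M)"
    using indep_varD[OF indep, of "{x}" "{y}"]
    by (simp add: vimage_def Int_def conj_commute)
  also have "\<dots> = measure (distr M (count_space UNIV) X) {x} *
      measure (distr M (count_space UNIV) Y) {y}"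
    by (simp add: measure_distr)
  finally show ?thesis
    by (simp add: X Y emeasure_eq_measure ennreal_mult pmf.rep_eq)
qed

text \<open>Splitting over the countably many values of \<open>X\<close> leaves only fixed indices,
  where independence factors each term. This is how a process is evaluated at an independent random
  time.\<close>

lemma distr_random_index:
  fixes X :: "'a \<Rightarrow> 'b::countable" and Y :: "'b \<Rightarrow> 'a \<Rightarrow> 'b"
  assumes X: "distr M (count_space UNIV) X = measure_pmf p"
    and Y: "\<And>x. distr M (count_space UNIV) (Y x) = measure_pmf (q x)"
    and indep: "\<And>x. indep_var (count_space UNIV) X (count_space UNIV) (Y x)"
  shows "distr M (count_space UNIV) (\<lambda>\<omega>. Y (X \<omega>) \<omega>) = measure_pmf (bind_pmf p q)"
proof -
  have [measurable]: "X \<in> measurable M (count_space UNIV)"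
      "Y x \<in> measurable M (count_space UNIV)" for x
    using indep_var_rv1[OF indep] indep_var_rv2[OF indep] by auto
  have YX [measurable]: "(\<lambda>\<omega>. Y (X \<omega>) \<omega>) \<in> measurable M (count_space UNIV)"
    by (rule measurable_compose_countable) auto
  show ?thesis
  proof (rule measure_eqI_countable[where A = UNIV])
    fix z :: 'b
    have "emeasure (distr M (count_space UNIV) (\<lambda>\<omega>. Y (X \<omega>) \<omega>)) {z} =
        emeasure M (\<Union>x. {\<omega> \<in> space M. X \<omega> = x \<and> Y x \<omega> = z})"
      by (subst emeasure_distr) (auto intro!: arg_cong[where f = "emeasure M"])
    also have "\<dots> = (\<integral>\<^sup>+x. emeasure M {\<omega> \<in> space M. X \<omega> = x \<and> Y x \<omega> = z} \<partial>count_space UNIV)"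
      by (rule emeasure_UN_countable) (auto simp: disjoint_family_on_def)
    also have "\<dots> = emeasure (bind_pmf p q) {z}"
      by (subst emeasure_bind_pmf)
        (simp add: emeasure_indep_var_eq[OF X Y indep] nn_integral_measure_pmf emeasure_pmf_single)
    finally show "emeasure (distr M (count_space UNIV) (\<lambda>\<omega>. Y (X \<omega>) \<omega>)) {z} =
        emeasure (bind_pmf p q) {z}" .
  qed auto
qed

lemma distr_Pair_indep:
  fixes X Y :: "'a \<Rightarrow> 'b::countable"
  assumes X: "distr M (count_space UNIV) X = measure_pmf p"
    and Y: "distr M (count_space UNIV) Y = measure_pmf q"
    and indep: "indep_var (count_space UNIV) X (count_space UNIV) Y"
  shows "distr M (count_space UNIV) (\<lambda>\<omega>. (X \<omega>, Y \<omega>)) = measure_pmf (pair_pmf p q)"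
proof (rule measure_eqI_countable[where A = UNIV])
  fix z :: "'b \<times> 'b"
  have "emeasure (distr M (count_space UNIV) (\<lambda>\<omega>. (X \<omega>, Y \<omega>))) {z} =
      emeasure M {\<omega> \<in> space M. X \<omega> = fst z \<and> Y \<omega> = snd z}"
    by (subst emeasure_distr[OF measurable_Pair_count_space[OF indep_var_rv1[OF indep]
            indep_var_rv2[OF indep]]])
      (auto intro!: arg_cong[where f = "emeasure M"])
  then show "emeasure (distr M (count_space UNIV) (\<lambda>\<omega>. (X \<omega>, Y \<omega>))) {z} =
      emeasure (pair_pmf p q) {z}"
    by (cases z)
      (simp add: emeasure_indep_var_eq[OF X Y indep] emeasure_pmf_single pmf_pair ennreal_mult)
qed auto

lemma indep_vars_imp_indep_var:
  assumes "indep_vars M' X I" "i \<in> I" "j \<in> I" "i \<noteq> j"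
  shows "indep_var (M' i) (X i) (M' j) (X j)"
proof -
  have "indep_var (PiM {i} M') (\<lambda>\<omega>. restrict (\<lambda>i. X i \<omega>) {i})
      (PiM {j} M') (\<lambda>\<omega>. restrict (\<lambda>i. X i \<omega>) {j})"
    by (rule indep_var_restrict) (use assms in auto)
  from indep_var_compose[OF this, of "\<lambda>f. f i" "M' i" "\<lambda>f. f j" "M' j"] show ?thesis
    by (simp add: comp_def)
qed

section \<open>Value and increment of a single Poisson process\<close>

lemma poisson_process_increment:
  assumes "poisson_process M l X" "0 < l" "0 \<le> s" "0 \<le> h"
  shows "distr M (count_space UNIV) (\<lambda>\<omega>. X (s + h) \<omega> - X s \<omega>) =
     measure_pmf (poisson_pmf0 (l * h))"
proof (cases "h = 0")
  case True
  have "distr M (count_space UNIV) (\<lambda>_. 0 :: nat) = return (count_space UNIV) 0"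
    by (rule measure_eqI) (auto simp: emeasure_distr emeasure_space_1 indicator_def)
  with True show ?thesis
    by (simp add: poisson_pmf0_def return_pmf.rep_eq)
next
  case False
  with assms have "s < s + h" by simp
  with assms have "distr M (count_space UNIV) (\<lambda>\<omega>. X (s + h) \<omega> - X s \<omega>) =
      measure_pmf (poisson_pmf (l * (s + h - s)))"
    unfolding poisson_process_def by blast
  with False assms(2) show ?thesis
    by (simp add: poisson_pmf0_def)
qed

text \<open>The defining conditions speak of strictly increasing times, so \<open>s = 0\<close> and
  \<open>h = 0\<close> are treated apart. Both occur later, where \<open>s\<close> and
  \<open>h\<close> are the value and the increment of another iterate.\<close>

lemma poisson_process_pair:
  assumes X: "poisson_process M l X" and l: "0 < l" and s: "0 \<le> s" and h: "0 \<le> h"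
  shows "distr M (count_space UNIV) (\<lambda>\<omega>. (X s \<omega>, X (s + h) \<omega> - X s \<omega>)) =
     measure_pmf (pair_pmf (poisson_pmf0 (l * s)) (poisson_pmf0 (l * h)))"
proof -
  have "X t \<in> measurable M (count_space UNIV)" if "0 \<le> t" for t
    using X that unfolding poisson_process_def by blast
  then have [measurable]: "X s \<in> measurable M (count_space UNIV)"
      "X (s + h) \<in> measurable M (count_space UNIV)"
    using s h by simp_all
  have X0: "X 0 \<omega> = 0" if "\<omega> \<in> space M" for \<omega>
    using X that unfolding poisson_process_def by blast
  have "distr M (count_space UNIV) (X s) =
      distr M (count_space UNIV) (\<lambda>\<omega>. X (0 + s) \<omega> - X 0 \<omega>)"
    by (intro distr_cong) (auto simp: X0)
  also have "\<dots> = measure_pmf (poisson_pmf0 (l * s))"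
    by (rule poisson_process_increment) (use assms in auto)
  finally have law_s: "distr M (count_space UNIV) (X s) = measure_pmf (poisson_pmf0 (l * s))" .
  note law_h = poisson_process_increment[OF X l s h]
  consider "s = 0" | "h = 0" | "0 < s" "0 < h" using s h by fastforce
  then show ?thesis
  proof cases
    case 1
    have "distr M (count_space UNIV) (\<lambda>\<omega>. (X s \<omega>, X (s + h) \<omega> - X s \<omega>)) =
        distr M (count_space UNIV) (\<lambda>\<omega>. (0, X (s + h) \<omega> - X s \<omega>))"
      by (intro distr_cong) (auto simp: X0 1)
    also have "\<dots> = measure_pmf (map_pmf (Pair 0) (poisson_pmf0 (l * h)))"
      by (rule distr_comp_count_space[OF _ law_h]) measurable
    finally show ?thesis
      by (simp add: 1 poisson_pmf0_def pair_return_pmf1)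
  next
    case 2
    have "distr M (count_space UNIV) (\<lambda>\<omega>. (X s \<omega>, 0 :: nat)) =
        measure_pmf (map_pmf (\<lambda>x. (x, 0)) (poisson_pmf0 (l * s)))"
      by (rule distr_comp_count_space[OF _ law_s]) measurable
    with 2 show ?thesis
      by (simp add: poisson_pmf0_def pair_return_pmf2)
  next
    case 3
    \<comment> \<open>Starting the grid at 0 turns \<open>X s\<close> into the first of two
      consecutive increments, because \<open>X 0\<close> is 0.\<close>
    define t :: "nat \<Rightarrow> real" where "t i = (if i = 0 then 0 else if i = 1 then s else s + h)" for i
    have "0 \<le> t 0 \<and> (\<forall>i<2. t i < t (Suc i))"
      using 3 by (auto simp: t_def less_Suc_eq numeral_2_eq_2)
    then have iv: "indep_vars (\<lambda>_. count_space UNIV) (\<lambda>i \<omega>. X (t (Suc i)) \<omega> - X (t i) \<omega>) {..<2}"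
      using X unfolding poisson_process_def by blast
    have "indep_var (count_space UNIV) (\<lambda>\<omega>. X s \<omega> - X 0 \<omega>)
        (count_space UNIV) (\<lambda>\<omega>. X (s + h) \<omega> - X s \<omega>)"
      using indep_vars_imp_indep_var[OF iv, of 0 1] by (simp add: t_def)
    moreover have "distr M (count_space UNIV) (\<lambda>\<omega>. X s \<omega> - X 0 \<omega>) =
        measure_pmf (poisson_pmf0 (l * s))"
      unfolding law_s[symmetric] by (intro distr_cong) (auto simp: X0)
    ultimately have "distr M (count_space UNIV) (\<lambda>\<omega>. (X s \<omega> - X 0 \<omega>, X (s + h) \<omega> - X s \<omega>)) =
        measure_pmf (pair_pmf (poisson_pmf0 (l * s)) (poisson_pmf0 (l * h)))"
      by (intro distr_Pair_indep law_h)
    moreover have "distr M (count_space UNIV) (\<lambda>\<omega>. (X s \<omega>, X (s + h) \<omega> - X s \<omega>)) =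
        distr M (count_space UNIV) (\<lambda>\<omega>. (X s \<omega> - X 0 \<omega>, X (s + h) \<omega> - X s \<omega>))"
      by (intro distr_cong) (auto simp: X0)
    ultimately show ?thesis by simp
  qed
qed

section \<open>Reading the first value off a fine grid\<close>

text \<open>Dominated convergence for indicators. Measurability of the limit event is derived: it is
  the event that \<open>P n\<close> holds for all large \<open>n\<close>. This spares a separate
  proof that the event on the first jump time is measurable.\<close>

lemma tendsto_prob_eventually_iff:
  assumes P: "\<And>n. {\<omega> \<in> space M. P n \<omega>} \<in> events"
    and ev: "\<And>\<omega>. \<omega> \<in> space M \<Longrightarrow> \<forall>\<^sub>F n in sequentially. P n \<omega> \<longleftrightarrow> Q \<omega>"
  shows "(\<lambda>n. prob {\<omega> \<in> space M. P n \<omega>}) \<longlonglongrightarrow> prob {\<omega> \<in> space M. Q \<omega>}"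
proof -
  have "Q \<omega> \<longleftrightarrow> (\<forall>\<^sub>F n in sequentially. P n \<omega>)" if "\<omega> \<in> space M" for \<omega>
  proof -
    have "(\<forall>\<^sub>F n in sequentially. P n \<omega>) \<longleftrightarrow> (\<forall>\<^sub>F n::nat in sequentially. Q \<omega>)"
      by (rule eventually_subst[OF ev[OF that]])
    then show ?thesis by simp
  qed
  then have "{\<omega> \<in> space M. Q \<omega>} = {\<omega> \<in> space M. eventually (\<lambda>n. P n \<omega>) sequentially}"
    by auto
  with P have Q: "{\<omega> \<in> space M. Q \<omega>} \<in> events"
    by auto
  have "(\<lambda>n. \<integral>\<omega>. indicator {\<omega> \<in> space M. P n \<omega>} \<omega> \<partial>M) \<longlonglongrightarrow>
      (\<integral>\<omega>. indicator {\<omega> \<in> space M. Q \<omega>} \<omega> \<partial>M :: real)"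
  proof (rule integral_dominated_convergence[where w = "\<lambda>_. 1"])
    show "AE \<omega> in M. (\<lambda>n. indicator {\<omega> \<in> space M. P n \<omega>} \<omega> :: real) \<longlonglongrightarrow>
        indicator {\<omega> \<in> space M. Q \<omega>} \<omega>"
    proof (rule AE_I2, rule tendsto_eventually)
      fix \<omega> assume "\<omega> \<in> space M"
      with ev show "\<forall>\<^sub>F n in sequentially. indicator {\<omega> \<in> space M. P n \<omega>} \<omega> =
          (indicator {\<omega> \<in> space M. Q \<omega>} \<omega> :: real)"
        by (intro eventually_mono[OF ev]) (auto simp: indicator_def)
    qed
  qed (use P Q in \<open>auto simp: indicator_def\<close>)
  with P Q show ?thesis by simp
qed

end

text \<open>A path that stays at 0 makes both sides false, as \<open>k\<close> is positive.
  Otherwise it is constant on some interval from the jump time \<open>J\<close> up to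
  \<open>b\<close>. Once the mesh is below \<open>b - J\<close>, the first grid point at or after
  \<open>J\<close> falls into that interval, and its predecessor still sees 0.\<close>

lemma eventually_grid_first_value:
  fixes X :: "real \<Rightarrow> 'a \<Rightarrow> nat"
  assumes X0: "X 0 \<omega> = 0" and mono: "mono_on {0..} (\<lambda>t. X t \<omega>)"
    and rcont: "\<And>t. 0 \<le> t \<Longrightarrow> \<forall>\<^sub>F s in at_right t. X s \<omega> = X t \<omega>"
    and k: "1 \<le> k"
  shows "\<forall>\<^sub>F n in sequentially.
     (\<exists>i. X (real i * (1 / real (Suc n))) \<omega> = 0 \<and>
          X (real (Suc i) * (1 / real (Suc n))) \<omega> = k) \<longleftrightarrow>
     (first_jump_time X \<omega> < \<infinity> \<and> X (real_of_ereal (first_jump_time X \<omega>)) \<omega> = k)"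
proof (cases "\<exists>t\<ge>0. X t \<omega> \<noteq> 0")
  case False
  then have "{ereal t | t. 0 \<le> t \<and> X t \<omega> \<noteq> 0} = {}" by auto
  then have "first_jump_time X \<omega> = \<infinity>"
    unfolding first_jump_time_def by (metis Inf_empty top_ereal_def)
  moreover have "X (real (Suc i) * (1 / real (Suc n))) \<omega> \<noteq> k" for i n
    using False k by (metis not_one_le_zero of_nat_0_le_iff divide_nonneg_nonneg zero_le_one mult_nonneg_nonneg)
  ultimately show ?thesis by simp
next
  case True
  define S where "S = {t. 0 \<le> t \<and> X t \<omega> \<noteq> 0}"
  define J where "J = Inf S"
  have S: "S \<noteq> {}" "bdd_below S"
    using True by (auto simp: S_def)
  have J0: "0 \<le> J"
    unfolding J_def by (rule cInf_greatest) (use S in \<open>auto simp: S_def\<close>)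
  have "first_jump_time X \<omega> = Inf (ereal ` S)"
    unfolding first_jump_time_def S_def by (rule arg_cong[where f = Inf]) auto
  also have "\<dots> = ereal J"
    unfolding J_def using S by (simp add: ereal_Inf' )
  finally have fj: "first_jump_time X \<omega> = ereal J" .
  have before: "X t \<omega> = 0" if "0 \<le> t" "t < J" for t
    using that cInf_lower[OF _ S(2), of t] unfolding J_def S_def by force
  obtain b where b: "J < b" "\<And>s. J < s \<Longrightarrow> s < b \<Longrightarrow> X s \<omega> = X J \<omega>"
    using rcont[OF J0] unfolding eventually_at_right_field by blast
  \<comment> \<open>The infimum is attained: were the path 0 at \<open>J\<close>, it would be 0 up
    to \<open>b\<close>, but \<open>S\<close> has a member below \<open>b\<close>.\<close>
  have XJ: "X J \<omega> \<noteq> 0"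
  proof
    assume "X J \<omega> = 0"
    obtain t where t: "t \<in> S" "t < b"
      using b(1) S unfolding J_def by (meson cInf_less_iff)
    have "J \<le> t" unfolding J_def by (rule cInf_lower[OF t(1) S(2)])
    with b(2)[of t] t \<open>X J \<omega> = 0\<close> show False
      by (cases "J = t") (auto simp: S_def)
  qed
  have Jpos: "0 < J"
    using J0 XJ X0 by (cases "J = 0") auto
  have "(\<lambda>n. 1 / real (Suc n)) \<longlonglongrightarrow> 0"
    by real_asymp
  then have "\<forall>\<^sub>F n in sequentially. 1 / real (Suc n) < b - J"
    by (rule order_tendstoD) (use b in simp)
  then show ?thesis
  proof (rule eventually_mono)
    fix n assume n: "1 / real (Suc n) < b - J"
    define h where "h = 1 / real (Suc n)"
    have h: "0 < h" "h < b - J" using n by (auto simp: h_def)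
    \<comment> \<open>\<open>Suc i0\<close> indexes the first grid point at or after
      \<open>J\<close>. The ceiling keeps \<open>real i0 * h < J\<close> strict even if
      \<open>J\<close> lies on the grid, and \<open>0 < J\<close> prevents truncation by
      \<open>nat\<close>.\<close>
    define i0 where "i0 = nat (\<lceil>J / h\<rceil> - 1)"
    have "0 < J / h" using Jpos h by simp
    then have "1 \<le> \<lceil>J / h\<rceil>" by linarith
    then have i0: "real i0 = of_int \<lceil>J / h\<rceil> - 1" by (simp add: i0_def)
    then have "real i0 < J / h" "J / h \<le> real (Suc i0)" by simp_all linarith+
    then have lt: "real i0 * h < J" and ge: "J \<le> real (Suc i0) * h"
      using h by (simp_all only: pos_less_divide_eq pos_divide_le_eq)
    have "real (Suc i0) * h < b" using lt h by (simp add: algebra_simps)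
    with ge b(2)[of "real (Suc i0) * h"] have XS: "X (real (Suc i0) * h) \<omega> = X J \<omega>"
      by (cases "J = real (Suc i0) * h") auto
    have Xi: "X (real i0 * h) \<omega> = 0" using before lt h by simp
    \<comment> \<open>A nondecreasing path leaves 0 in only one grid step.\<close>
    have uniq: "i = i0" if "X (real i * h) \<omega> = 0" "X (real (Suc i) * h) \<omega> = k" for i
    proof -
      have mon: "X (real a * h) \<omega> \<le> X (real c * h) \<omega>" if "a \<le> c" for a c
        using mono h that by (auto simp: mono_on_def intro!: mult_right_mono)
      have "\<not> Suc i \<le> i0" using mon[of "Suc i" i0] that Xi k by linarith
      moreover have "\<not> Suc i0 \<le> i" using mon[of "Suc i0" i] that XS XJ by linarith
      ultimately show ?thesis by simp
    qed
    have "(\<exists>i. X (real i * h) \<omega> = 0 \<and> X (real (Suc i) * h) \<omega> = k) \<longleftrightarrow> X J \<omega> = k"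
      using uniq Xi XS by metis
    then show "(\<exists>i. X (real i * (1 / real (Suc n))) \<omega> = 0 \<and>
          X (real (Suc i) * (1 / real (Suc n))) \<omega> = k) \<longleftrightarrow>
     (first_jump_time X \<omega> < \<infinity> \<and> X (real_of_ereal (first_jump_time X \<omega>)) \<omega> = k)"
      by (simp add: fj h_def)
  qed
qed

section \<open>Paths and measurability of the iterates\<close>

text \<open>Every inner time is a natural number, so negative times never enter. This allows each
  process to be replaced by its path restricted to \<open>{0..}\<close>.\<close>

lemma mipp_cong:
  assumes "\<And>i t. i \<in> {1..m} \<Longrightarrow> 0 \<le> t \<Longrightarrow> N i t \<omega> = N' i t \<omega>'" "0 \<le> t"
  shows "mipp N m t \<omega> = mipp N' m t \<omega>'"
  using assms by (induction N m t \<omega> rule: mipp.induct) auto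

lemma measurable_PiM_PiM_component:
  assumes "i \<in> I" "t \<in> T"
  shows "(\<lambda>w. w i t) \<in> measurable (PiM I (\<lambda>_. PiM T (\<lambda>_. K))) K"
  using measurable_compose[OF
      measurable_component_singleton[OF assms(1), of "\<lambda>_. PiM T (\<lambda>_. K)"]
      measurable_component_singleton[OF assms(2), of "\<lambda>_. K"]]
  by simp

text \<open>This presents the iterate as a measurable functional of the paths, the form in which
  independence of processes applies. Despite the uncountable time axis, evaluation at an inner
  iterate is measurable because that iterate has countably many values.\<close>

lemma measurable_mipp_PiM:
  assumes "0 \<le> t"
  shows "mipp (\<lambda>i t w. w i t) m t \<in>
    measurable (PiM {1..m} (\<lambda>_. PiM {0..} (\<lambda>_. count_space UNIV))) (count_space UNIV)"
proof -
  let ?P = "\<lambda>I. PiM I (\<lambda>_. PiM {0::real..} (\<lambda>_. count_space (UNIV :: nat set)))"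
  have eval: "(\<lambda>w. w i s) \<in> measurable (?P I) (count_space UNIV)" if "i \<in> I" "0 \<le> s" for i s and I :: "nat set"
    by (rule measurable_PiM_PiM_component) (use that in auto)
  \<comment> \<open>The product space over \<open>{1..m}\<close> stays fixed while the order
    \<open>m'\<close> varies, so all levels live on the same space.\<close>
  have "mipp (\<lambda>i t w. w i t) m' t \<in> measurable (?P {1..m}) (count_space UNIV)" if "m' \<le> m" for m'
    using that
  proof (induction m' rule: less_induct)
    case (less m')
    consider "m' = 0" | "m' = 1" | j where "m' = Suc (Suc j)"
      by (metis One_nat_def not0_implies_Suc)
    then show ?case
    proof cases
      case 3
      have "(\<lambda>w. (\<lambda>x w. w (Suc (Suc j)) (real x)) (mipp (\<lambda>i t w. w i t) (Suc j) t w) w)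
          \<in> measurable (?P {1..m}) (count_space UNIV)"
      proof (rule measurable_compose_countable)
        show "(\<lambda>w. w (Suc (Suc j)) (real x)) \<in> measurable (?P {1..m}) (count_space UNIV)" for x :: nat
          by (rule eval) (use less.prems 3 in auto)
        show "mipp (\<lambda>i t w. w i t) (Suc j) t \<in> measurable (?P {1..m}) (count_space UNIV)"
          by (rule less.IH) (use less.prems 3 in auto)
      qed
      then show ?thesis by (simp add: 3)
    qed (use eval[of 1 "{1..m}" t] less.prems assms in \<open>simp_all\<close>)
  qed
  then show ?thesis by simp
qed

locale poisson_family = prob_space M for M :: "'a measure" +
  fixes l :: real and N :: "nat \<Rightarrow> real \<Rightarrow> 'a \<Rightarrow> nat"
  assumes l_pos: "0 < l"
    and poisson: "\<And>i. 1 \<le> i \<Longrightarrow> poisson_process M l (N i)"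
    and indep: "indep_processes M {1..} N"
begin

lemma N_path:
  assumes "1 \<le> i" "\<omega> \<in> space M"
  shows "N i 0 \<omega> = 0" "mono_on {0..} (\<lambda>t. N i t \<omega>)"
    "0 \<le> t \<Longrightarrow> continuous (at_right t) (\<lambda>s. N i s \<omega>)"
  using poisson[OF assms(1)] assms(2) unfolding poisson_process_def by blast+

lemma N_measurable: "1 \<le> i \<Longrightarrow> 0 \<le> t \<Longrightarrow> N i t \<in> measurable M (count_space UNIV)"
  using poisson[of i] unfolding poisson_process_def by blast

lemma mipp_measurable:
  assumes "0 \<le> t"
  shows "mipp N (Suc m) t \<in> measurable M (count_space UNIV)"
proof (induction m)
  case 0
  then show ?case using N_measurable[of 1 t] assms by simp
next
  case (Suc m)
  have "(\<lambda>\<omega>. (\<lambda>x. N (Suc (Suc m)) (real x)) (mipp N (Suc m) t \<omega>) \<omega>) \<in> measurable M (count_space UNIV)"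
    by (rule measurable_compose_countable[OF _ Suc]) (auto intro: N_measurable)
  then show ?case by simp
qed

lemma mipp_zero: "\<omega> \<in> space M \<Longrightarrow> mipp N (Suc m) 0 \<omega> = 0"
  by (induction m) (simp_all add: N_path)

lemma mipp_mono:
  assumes "\<omega> \<in> space M" "0 \<le> s" "s \<le> t"
  shows "mipp N (Suc m) s \<omega> \<le> mipp N (Suc m) t \<omega>"
proof (induction m)
  case 0
  then show ?case using N_path(2)[of 1 \<omega>] assms by (auto simp: mono_on_def)
next
  case (Suc m)
  then show ?case using N_path(2)[of "Suc (Suc m)" \<omega>] assms(1) by (auto simp: mono_on_def)
qed

text \<open>For discrete values, right continuity is local constancy to the right. Only
  \<open>N 1\<close> runs in real time; each further level is a function of the value below it and
  inherits the constancy.\<close>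

lemma mipp_eventually_const_at_right:
  assumes "\<omega> \<in> space M" "0 \<le> t"
  shows "\<forall>\<^sub>F s in at_right t. mipp N (Suc m) s \<omega> = mipp N (Suc m) t \<omega>"
proof (induction m)
  case 0
  then show ?case
    using N_path(3)[of 1 \<omega> t] assms by (simp add: continuous_within tendsto_discrete)
qed (auto elim: eventually_mono)

section \<open>Independent stationary increments of the iterates\<close>

text \<open>The first pair depends only on the paths numbered 1 to \<open>Suc m\<close>, the second
  only on the path numbered \<open>Suc (Suc m)\<close>; disjoint blocks of an independent family are
  independent.\<close>

lemma indep_mipp_next:
  assumes s: "0 \<le> s" and h: "0 \<le> h" and a: "0 \<le> a" and b: "0 \<le> b"
  shows "indep_var (count_space UNIV)
      (\<lambda>\<omega>. (mipp N (Suc m) s \<omega>, mipp N (Suc m) (s + h) \<omega> - mipp N (Suc m) s \<omega>))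
    (count_space UNIV)
      (\<lambda>\<omega>. (N (Suc (Suc m)) a \<omega>, N (Suc (Suc m)) (a + b) \<omega> - N (Suc (Suc m)) a \<omega>))"
proof -
  let ?C = "\<lambda>_::nat. PiM {0::real..} (\<lambda>_. count_space (UNIV :: nat set))"
  let ?X = "\<lambda>i \<omega>. \<lambda>t\<in>{0..}. N i t \<omega>"
  let ?A = "{1..Suc m}" and ?B = "{Suc (Suc m)}"
  define V where "V t = mipp (\<lambda>i t (w :: nat \<Rightarrow> real \<Rightarrow> nat). w i t) (Suc m) t" for t
  define f where "f w = (V s w, V (s + h) w - V s w)" for w
  define g where "g w = (w (Suc (Suc m)) a, w (Suc (Suc m)) (a + b) - w (Suc (Suc m)) a)"
    for w :: "nat \<Rightarrow> real \<Rightarrow> nat"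
  have "indep_vars ?C ?X {1..}"
    using indep unfolding indep_processes_def .
  then have iv: "indep_var (PiM ?A ?C) (\<lambda>\<omega>. restrict (\<lambda>i. ?X i \<omega>) ?A)
      (PiM ?B ?C) (\<lambda>\<omega>. restrict (\<lambda>i. ?X i \<omega>) ?B)"
    by (rule indep_var_restrict) auto
  have V: "V t \<in> measurable (PiM ?A ?C) (count_space UNIV)" if "0 \<le> t" for t
    unfolding V_def by (rule measurable_mipp_PiM[OF that])
  have f: "f \<in> measurable (PiM ?A ?C) (count_space UNIV)"
    unfolding f_def
    by (intro measurable_Pair_increment V) (use s h in auto)
  have eval: "(\<lambda>w. w (Suc (Suc m)) t) \<in> measurable (PiM ?B ?C) (count_space UNIV)" if "0 \<le> t" for t
    by (rule measurable_PiM_PiM_component) (use that in auto)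
  have g: "g \<in> measurable (PiM ?B ?C) (count_space UNIV)"
    unfolding g_def
    by (intro measurable_Pair_increment eval) (use a b in auto)
  have V_eq: "V t (restrict (\<lambda>i. ?X i \<omega>) ?A) = mipp N (Suc m) t \<omega>" if "0 \<le> t" for t \<omega>
    unfolding V_def by (rule mipp_cong) (use that in auto)
  have "f \<circ> (\<lambda>\<omega>. restrict (\<lambda>i. ?X i \<omega>) ?A) =
      (\<lambda>\<omega>. (mipp N (Suc m) s \<omega>, mipp N (Suc m) (s + h) \<omega> - mipp N (Suc m) s \<omega>))"
    using s h by (simp only: fun_eq_iff comp_apply f_def V_eq add_nonneg_nonneg simp_thms)
  moreover have "g \<circ> (\<lambda>\<omega>. restrict (\<lambda>i. ?X i \<omega>) ?B) =
      (\<lambda>\<omega>. (N (Suc (Suc m)) a \<omega>, N (Suc (Suc m)) (a + b) \<omega> - N (Suc (Suc m)) a \<omega>))"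
    using a b by (simp add: fun_eq_iff g_def)
  ultimately show ?thesis
    using indep_var_compose[OF iv f g] by metis
qed

text \<open>If the lower iterate has value \<open>a\<close> and increment \<open>b\<close>, the next
  process contributes its value at \<open>a\<close> and its increment from \<open>a\<close> to
  \<open>a + b\<close>, which are independent Poisson variables with means \<open>l * a\<close> and
  \<open>l * b\<close>. Carrying the pair through the induction preserves independence and
  stationarity together.\<close>

lemma distr_mipp_pair:
  assumes "0 \<le> s" "0 \<le> h"
  shows "distr M (count_space UNIV)
      (\<lambda>\<omega>. (mipp N (Suc m) s \<omega>, mipp N (Suc m) (s + h) \<omega> - mipp N (Suc m) s \<omega>)) =
    measure_pmf (pair_pmf (iterated_poisson_pmf l m s) (iterated_poisson_pmf l m h))"
proof (induction m)
  case 0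
  then show ?case
    using poisson_process_pair[OF poisson l_pos assms, of 1] by simp
next
  case (Suc m)
  define X where [abs_def]: "X \<omega> = (mipp N (Suc m) s \<omega>, mipp N (Suc m) (s + h) \<omega> - mipp N (Suc m) s \<omega>)" for \<omega>
  define Y where [abs_def]: "Y x \<omega> = (let a = real (fst x); b = real (snd x) in
      (N (Suc (Suc m)) a \<omega>, N (Suc (Suc m)) (a + b) \<omega> - N (Suc (Suc m)) a \<omega>))"
    for \<omega> and x :: "nat \<times> nat"
  let ?p = "pair_pmf (iterated_poisson_pmf l m s) (iterated_poisson_pmf l m h)"
  let ?q = "\<lambda>x :: nat \<times> nat.
      pair_pmf (poisson_pmf0 (l * real (fst x))) (poisson_pmf0 (l * real (snd x)))"
  have "distr M (count_space UNIV) (\<lambda>\<omega>. Y (X \<omega>) \<omega>) = measure_pmf (bind_pmf ?p ?q)"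
  proof (rule distr_random_index[where X = X and Y = Y and p = ?p and q = ?q])
    show "distr M (count_space UNIV) X = measure_pmf ?p"
      unfolding X_def by (rule Suc.IH)
    show "distr M (count_space UNIV) (Y x) = measure_pmf (?q x)" for x
      unfolding Y_def Let_def by (rule poisson_process_pair[OF poisson l_pos]) auto
    show "indep_var (count_space UNIV) X (count_space UNIV) (Y x)" for x
      unfolding X_def Y_def Let_def by (rule indep_mipp_next) (use assms in auto)
  qed
  also have "distr M (count_space UNIV) (\<lambda>\<omega>. Y (X \<omega>) \<omega>) = distr M (count_space UNIV)
      (\<lambda>\<omega>. (mipp N (Suc (Suc m)) s \<omega>, mipp N (Suc (Suc m)) (s + h) \<omega> - mipp N (Suc (Suc m)) s \<omega>))"
  proof (intro distr_cong refl)
    fix \<omega> assume "\<omega> \<in> space M"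
    \<comment> \<open>Monotonicity makes the truncated subtraction exact, so value plus increment is
      the iterate at \<open>s + h\<close>.\<close>
    then have "mipp N (Suc m) s \<omega> \<le> mipp N (Suc m) (s + h) \<omega>"
      using assms by (intro mipp_mono) auto
    then show "Y (X \<omega>) \<omega> =
      (mipp N (Suc (Suc m)) s \<omega>, mipp N (Suc (Suc m)) (s + h) \<omega> - mipp N (Suc (Suc m)) s \<omega>)"
      by (simp add: X_def Y_def Let_def of_nat_diff)
  qed
  also have "bind_pmf ?p ?q =
      pair_pmf (iterated_poisson_pmf l (Suc m) s) (iterated_poisson_pmf l (Suc m) h)"
    \<comment> \<open>One side draws both lower values before the upper ones, the other finishes one
      coordinate first; exchanging two independent draws identifies them.\<close>
    by (simp add: pair_pmf_def bind_assoc_pmf bind_return_pmf)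
      (subst bind_commute_pmf[of _ "poisson_pmf0 _"], rule refl)
  finally show ?case .
qed

text \<open>This is the first marginal of the pair law, taken with \<open>h = 0\<close>.\<close>

lemma distr_mipp:
  assumes "0 \<le> t"
  shows "distr M (count_space UNIV) (mipp N (Suc m) t) = measure_pmf (iterated_poisson_pmf l m t)"
  using distr_comp_count_space[OF _ distr_mipp_pair[OF assms order.refl, of m], of fst]
    measurable_Pair_count_space[OF mipp_measurable[OF assms] measurable_const[of 0], of m]
  by (simp add: map_fst_pair_pmf)

lemma prob_mipp:
  assumes "0 \<le> t"
  shows "\<P>(\<omega> in M. mipp N (Suc m) t \<omega> \<in> A) = measure (iterated_poisson_pmf l m t) A"
  unfolding distr_mipp[OF assms, symmetric]
  by (subst measure_distr[OF mipp_measurable[OF assms]])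
    (auto intro!: arg_cong[where f = prob])

lemma mipp_event:
  assumes "0 \<le> t"
  shows "{\<omega> \<in> space M. mipp N (Suc m) t \<omega> = a} \<in> events"
proof -
  have "mipp N (Suc m) t -` {a} \<inter> space M \<in> events"
    by (rule measurable_sets[OF mipp_measurable[OF assms]]) auto
  then show ?thesis by (simp add: vimage_def Int_def conj_commute)
qed

section \<open>The first nonzero value on a grid\<close>

lemma prob_mipp_increment:
  assumes "0 \<le> s" "0 \<le> h"
  shows "\<P>(\<omega> in M. mipp N (Suc m) s \<omega> = 0 \<and> mipp N (Suc m) (s + h) \<omega> = b) =
    pmf (iterated_poisson_pmf l m s) 0 * pmf (iterated_poisson_pmf l m h) b"
proof -
  let ?Z = "\<lambda>\<omega>. (mipp N (Suc m) s \<omega>, mipp N (Suc m) (s + h) \<omega> - mipp N (Suc m) s \<omega>)"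
  have m: "?Z \<in> measurable M (count_space UNIV)"
    by (intro measurable_Pair_increment mipp_measurable) (use assms in auto)
  \<comment> \<open>Where the iterate is 0 at \<open>s\<close>, its increment equals its value at
    \<open>s + h\<close>.\<close>
  have "\<P>(\<omega> in M. mipp N (Suc m) s \<omega> = 0 \<and> mipp N (Suc m) (s + h) \<omega> = b) =
      prob (?Z -` {(0, b)} \<inter> space M)"
    by (rule arg_cong[where f = prob]) auto
  also have "\<dots> = measure (distr M (count_space UNIV) ?Z) {(0, b)}"
    by (rule measure_distr[OF m, symmetric]) auto
  also have "\<dots> = pmf (iterated_poisson_pmf l m s) 0 * pmf (iterated_poisson_pmf l m h) b"
    unfolding distr_mipp_pair[OF assms] by (simp add: pmf_pair measure_pmf_single)
  finally show ?thesis .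
qed

text \<open>An identity between laws, obtained from the process: by monotonicity, being 0 at a grid
  time means being 0 at the previous one and gaining nothing since, and these two factor.\<close>

lemma pmf_iterated_poisson_0_mult:
  assumes "0 \<le> h"
  shows "pmf (iterated_poisson_pmf l m (real i * h)) 0 = pmf (iterated_poisson_pmf l m h) 0 ^ i"
proof (induction i)
  case (Suc i)
  have eq: "real (Suc i) * h = real i * h + h"
    by (simp add: algebra_simps)
  have "pmf (iterated_poisson_pmf l m (real (Suc i) * h)) 0 =
      \<P>(\<omega> in M. mipp N (Suc m) (real (Suc i) * h) \<omega> = 0)"
    using prob_mipp[of "real (Suc i) * h" m "{0}"] assms by (simp add: pmf.rep_eq)
  also have "\<dots> = \<P>(\<omega> in M. mipp N (Suc m) (real i * h) \<omega> = 0 \<and>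
      mipp N (Suc m) (real i * h + h) \<omega> = 0)"
  proof (rule arg_cong[where f = prob])
    show "{\<omega> \<in> space M. mipp N (Suc m) (real (Suc i) * h) \<omega> = 0} =
      {\<omega> \<in> space M. mipp N (Suc m) (real i * h) \<omega> = 0 \<and> mipp N (Suc m) (real i * h + h) \<omega> = 0}"
      using mipp_mono[of _ "real i * h" "real i * h + h" m] assms unfolding eq by fastforce
  qed
  also have "\<dots> = pmf (iterated_poisson_pmf l m h) 0 ^ Suc i"
    using assms by (subst prob_mipp_increment) (auto simp: Suc.IH)
  finally show ?case .
qed simp

lemma prob_grid_first_value:
  assumes h: "0 < h" and k: "1 \<le> k"
  shows "\<P>(\<omega> in M. \<exists>i. mipp N (Suc m) (real i * h) \<omega> = 0 \<and> mipp N (Suc m) (real (Suc i) * h) \<omega> = k) =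
    measure (iterated_poisson_pmf l m h) {k} / measure (iterated_poisson_pmf l m h) {1..}"
proof -
  let ?p = "iterated_poisson_pmf l m h"
  define F where "F i = {\<omega> \<in> space M. mipp N (Suc m) (real i * h) \<omega> = 0 \<and>
      mipp N (Suc m) (real (Suc i) * h) \<omega> = k}" for i
  have F: "range F \<subseteq> events"
    using h by (auto simp: F_def simp del: mipp.simps of_nat_Suc
        intro!: sets.sets_Collect_conj mipp_event)
  \<comment> \<open>On \<open>F i\<close> the iterate is already positive at grid point
    \<open>Suc i\<close>, whereas \<open>F j\<close> requires 0 at the same or a later
    point.\<close>
  have "F i \<inter> F j = {}" if "i < j" for i j
  proof -
    have "mipp N (Suc m) (real (Suc i) * h) \<omega> \<le> mipp N (Suc m) (real j * h) \<omega>"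
      if "\<omega> \<in> space M" for \<omega>
      using \<open>i < j\<close> h that by (intro mipp_mono mult_right_mono) auto
    then show ?thesis
      using k by (fastforce simp: F_def simp del: mipp.simps of_nat_Suc)
  qed
  then have "disjoint_family F"
    unfolding disjoint_family_on_def by (metis Int_commute nat_neq_iff)
  with F have "(\<lambda>i. prob (F i)) sums prob (\<Union>i. F i)"
    by (rule finite_measure_UNION)
  moreover have "prob (F i) = pmf ?p 0 ^ i * pmf ?p k" for i
  proof -
    have "real (Suc i) * h = real i * h + h"
      by (simp add: algebra_simps)
    then show ?thesis
      using prob_mipp_increment[of "real i * h" h m k] h
      by (simp add: F_def pmf_iterated_poisson_0_mult del: mipp.simps of_nat_Suc)
  qed
  ultimately have "(\<lambda>i. pmf ?p 0 ^ i * pmf ?p k) sums prob (\<Union>i. F i)"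
    by simp
  moreover have compl: "measure ?p {1..} = 1 - pmf ?p 0"
  proof -
    have "{1..} = space ?p - {0 :: nat}" by auto
    then show ?thesis
      by (simp only: measure_pmf.prob_compl sets_measure_pmf UNIV_I pmf.rep_eq)
  qed
  \<comment> \<open>Positivity says that \<open>pmf ?p 0\<close> is below 1, which makes the
    geometric series converge.\<close>
  moreover have "0 < measure ?p {1..}"
    using l_pos h by (intro measure_iterated_poisson_pmf_pos) auto
  then have "(\<lambda>i. pmf ?p 0 ^ i * pmf ?p k) sums (1 / (1 - pmf ?p 0) * pmf ?p k)"
    by (intro sums_mult2 geometric_sums) (simp only: compl, simp)
  ultimately have "prob (\<Union>i. F i) = pmf ?p k / measure ?p {1..}"
    using sums_unique2 by (fastforce simp: compl)
  moreover have "(\<Union>i. F i) = {\<omega> \<in> space M. \<exists>i. mipp N (Suc m) (real i * h) \<omega> = 0 \<and>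
      mipp N (Suc m) (real (Suc i) * h) \<omega> = k}"
    by (auto simp: F_def)
  ultimately show ?thesis
    by (simp add: pmf.rep_eq del: mipp.simps of_nat_Suc)
qed

section \<open>Letting the mesh tend to 0\<close>

lemma prob_first_value:
  assumes k: "1 \<le> k"
  shows "\<P>(\<omega> in M. first_jump_time (mipp N (Suc (Suc m))) \<omega> < \<infinity> \<and>
      mipp N (Suc (Suc m)) (real_of_ereal (first_jump_time (mipp N (Suc (Suc m))) \<omega>)) \<omega> = k) =
    measure (iterated_poisson_pmf l m 1) {k} / measure (iterated_poisson_pmf l m 1) {1..}"
proof -
  let ?V = "mipp N (Suc (Suc m))"
  let ?m = "\<lambda>h. measure (iterated_poisson_pmf l (Suc m) h)"
  define h where "h n = 1 / real (Suc n)" for n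
  have h: "0 < h n" for n by (simp add: h_def)
  have "(\<lambda>n. \<P>(\<omega> in M. \<exists>i. ?V (real i * h n) \<omega> = 0 \<and> ?V (real (Suc i) * h n) \<omega> = k)) \<longlonglongrightarrow>
      \<P>(\<omega> in M. first_jump_time ?V \<omega> < \<infinity> \<and> ?V (real_of_ereal (first_jump_time ?V \<omega>)) \<omega> = k)"
  proof (rule tendsto_prob_eventually_iff)
    show "{\<omega> \<in> space M. \<exists>i. ?V (real i * h n) \<omega> = 0 \<and> ?V (real (Suc i) * h n) \<omega> = k} \<in> events" for n
      using h[of n] by (intro sets.sets_Collect_countable_Ex sets.sets_Collect_conj mipp_event) auto
    show "\<forall>\<^sub>F n in sequentially. (\<exists>i. ?V (real i * h n) \<omega> = 0 \<and> ?V (real (Suc i) * h n) \<omega> = k) \<longleftrightarrow>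
        (first_jump_time ?V \<omega> < \<infinity> \<and> ?V (real_of_ereal (first_jump_time ?V \<omega>)) \<omega> = k)"
      if "\<omega> \<in> space M" for \<omega>
      unfolding h_def
      by (rule eventually_grid_first_value[where X = ?V, OF mipp_zero[OF that] _
            mipp_eventually_const_at_right[OF that] k])
        (auto simp: mono_on_def simp del: mipp.simps intro!: mipp_mono that)
  qed
  then have "(\<lambda>n. ?m (h n) {k} / ?m (h n) {1..}) \<longlonglongrightarrow>
      \<P>(\<omega> in M. first_jump_time ?V \<omega> < \<infinity> \<and> ?V (real_of_ereal (first_jump_time ?V \<omega>)) \<omega> = k)"
    unfolding prob_grid_first_value[OF h k] .
  moreover have "(\<lambda>n. ?m (h n) {k} / ?m (h n) {1..}) \<longlonglongrightarrow>
      measure (iterated_poisson_pmf l m 1) {k} / measure (iterated_poisson_pmf l m 1) {1..}"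
  proof -
    have h_lim: "filterlim h (at_right 0) sequentially"
      unfolding h_def by real_asymp
    have lim: "(\<lambda>n. ?m (h n) A / h n) \<longlonglongrightarrow> l * measure (iterated_poisson_pmf l m 1) A"
      if "0 \<notin> A" for A
      by (rule filterlim_compose[OF iterated_poisson_pmf_small_time[OF l_pos that] h_lim])
    have "0 < measure (iterated_poisson_pmf l m 1) {1..}"
      using l_pos by (intro measure_iterated_poisson_pmf_pos) auto
    \<comment> \<open>Dividing numerator and denominator by \<open>h n\<close> gives each a finite
      limit, the lower one nonzero; the common factor \<open>l\<close> then cancels.\<close>
    then have "(\<lambda>n. (?m (h n) {k} / h n) / (?m (h n) {1..} / h n)) \<longlonglongrightarrow>
        (l * measure (iterated_poisson_pmf l m 1) {k}) / (l * measure (iterated_poisson_pmf l m 1) {1..})"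
      using k l_pos by (intro tendsto_divide lim) auto
    moreover have "(?m (h n) {k} / h n) / (?m (h n) {1..} / h n) = ?m (h n) {k} / ?m (h n) {1..}" for n
      using h[of n] by simp
    ultimately have "(\<lambda>n. ?m (h n) {k} / ?m (h n) {1..}) \<longlonglongrightarrow>
        (l * measure (iterated_poisson_pmf l m 1) {k}) / (l * measure (iterated_poisson_pmf l m 1) {1..})"
      by (simp only:)
    then show ?thesis
      using l_pos by (simp del: iterated_poisson_pmf.simps)
  qed
  ultimately show ?thesis
    by (rule LIMSEQ_unique)
qed

end

theorem proposition2p6:
  fixes M :: "'a measure" and l :: real
    and N :: "nat \<Rightarrow> real \<Rightarrow> 'a \<Rightarrow> nat" and n k :: nat
  assumes "prob_space M"
    and "0 < l"
    and "\<And>i. 1 \<le> i \<Longrightarrow> poisson_process M l (N i)"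
    and "indep_processes M {1..} N"
    and "2 \<le> n"
    and "1 \<le> k"
  shows "\<P>(\<omega> in M. first_jump_time (mipp N n) \<omega> < \<infinity> \<and>
            mipp N n (real_of_ereal (first_jump_time (mipp N n) \<omega>)) \<omega> = k)
       = \<P>(\<omega> in M. mipp N (n - 1) 1 \<omega> = k) / \<P>(\<omega> in M. mipp N (n - 1) 1 \<omega> \<ge> 1)"
proof -
  interpret poisson_family M l N
    using assms by (simp add: poisson_family_def poisson_family_axioms_def)
  \<comment> \<open>Law index \<open>m\<close> belongs to order \<open>Suc m\<close>, which is
    \<open>n - 1\<close> here.\<close>
  obtain m where n: "n = Suc (Suc m)"
    using assms(5) by (metis Suc_le_D numeral_2_eq_2 Suc_le_mono)
  show ?thesis
    using prob_first_value[OF assms(6), of m] prob_mipp[of 1 m "{k}"] prob_mipp[of 1 m "{1..}"]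
    unfolding n by simp
qed

end
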